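(* Let $K$ be a field, $n\ge 2$, $S=K[x_1,\ldots,x_{n+1}]$, and let $I_2(N)$ be the ideal of $S$ generated by the $2\times 2$ minors of $$N=\begin{pmatrix} x_1&x_2&x_3&\cdots&x_n\\ x_2&x_3&x_4&\cdots&x_{n+1}\end{pmatrix}.$$ Let $a,b,c\in\mathbb{N}$ and let $J=\langle x_1^a+x_{n+1}^b,\ x_n^c\rangle\subseteq S$. Then $I_2(N)\cap J=I_2(N)\cdot J$.
   Context: $\mathbb{N}=\{1,2,3,\ldots\}$. *)

theory Defs
  imports
    "HOL-Library.Poly_Mapping"
    "HOL-Algebra.Ideal_Product"
    "Jordan_Normal_Form.Determinant"
    "Jordan_Normal_Form.DL_Submatrix"
begin

text \<open>A multivariate polynomial with coefficients in \<open>'a\<close> and indeterminates named by \<open>'v\<close> is a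
  finitely supported function from exponent vectors to coefficients. The ring operations are
  the convolution operations of \<^theory>\<open>HOL-Library.Poly_Mapping\<close>.\<close>

type_synonym ('v, 'a) mvpoly = "('v \<Rightarrow>\<^sub>0 nat) \<Rightarrow>\<^sub>0 'a"

definition X :: "'v \<Rightarrow> ('v, 'a::comm_ring_1) mvpoly" where
  "X i = Poly_Mapping.single (Poly_Mapping.single i 1) 1"

text \<open>\<open>poly_ring V\<close> is \<open>'a[X i | i \<in> V]\<close>: the polynomials all of whose monomials involve only
  indeterminates from \<open>V\<close>. It is packaged as a HOL-Algebra ring so that ideals, generated ideals
  and products of ideals are taken in this ring and not in the polynomial ring over all of
  \<open>'v\<close>.\<close>

definition poly_ring :: "'v set \<Rightarrow> ('v, 'a::comm_ring_1) mvpoly ring" where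
  "poly_ring V =
     \<lparr> carrier = {p. \<forall>m \<in> Poly_Mapping.keys p. Poly_Mapping.keys m \<subseteq> V},
       monoid.mult = (*), one = 1, zero = 0, add = (+) \<rparr>"

lemma poly_ring_simps [simp]:
  "monoid.mult (poly_ring V) = (*)" "one (poly_ring V) = 1"
  "zero (poly_ring V) = 0" "add (poly_ring V) = (+)"
  by (simp_all add: poly_ring_def)

lemma mem_carrier_poly_ring:
  "p \<in> carrier (poly_ring V) \<longleftrightarrow> (\<forall>m \<in> Poly_Mapping.keys p. Poly_Mapping.keys m \<subseteq> V)"
  by (simp add: poly_ring_def)

lemma X_in_carrier: "i \<in> V \<Longrightarrow> X i \<in> carrier (poly_ring V)"
  by (auto simp: mem_carrier_poly_ring X_def)

lemma cring_poly_ring: "cring (poly_ring V :: ('v, 'a::comm_ring_1) mvpoly ring)"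
proof (rule cringI)
  let ?R = "poly_ring V :: ('v, 'a) mvpoly ring"
  have add: "p + q \<in> carrier ?R" if "p \<in> carrier ?R" "q \<in> carrier ?R" for p q
    using that Poly_Mapping.keys_add[of p q] by (auto simp: mem_carrier_poly_ring)
  have mult: "p * q \<in> carrier ?R" if pq: "p \<in> carrier ?R" "q \<in> carrier ?R" for p q
    unfolding mem_carrier_poly_ring
  proof
    fix m assume "m \<in> Poly_Mapping.keys (p * q)"
    then obtain k l where kl: "k \<in> Poly_Mapping.keys p" "l \<in> Poly_Mapping.keys q" "m = k + l"
      using keys_mult[of p q] by auto
    with pq show "Poly_Mapping.keys m \<subseteq> V"
      using Poly_Mapping.keys_add[of k l] by (fastforce simp: mem_carrier_poly_ring)
  qed
  have uminus: "- p \<in> carrier ?R" if "p \<in> carrier ?R" for p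
    using that by (auto simp: mem_carrier_poly_ring in_keys_iff)
  show "abelian_group ?R"
  proof (rule abelian_groupI)
    fix p assume "p \<in> carrier ?R"
    then show "\<exists>q\<in>carrier ?R. q \<oplus>\<^bsub>?R\<^esub> p = \<zero>\<^bsub>?R\<^esub>"
      using uminus by (intro bexI[of _ "- p"]) auto
  qed (auto simp: add algebra_simps, auto simp: mem_carrier_poly_ring)
  show "comm_monoid ?R"
    by (rule comm_monoidI) (auto simp: mult algebra_simps, auto simp: mem_carrier_poly_ring)
qed (auto simp: algebra_simps)

definition minors :: "nat \<Rightarrow> 'a::comm_ring_1 mat \<Rightarrow> 'a set" where
  "minors t A = {det (submatrix A I J) | I J.
     I \<subseteq> {..<dim_row A} \<and> J \<subseteq> {..<dim_col A} \<and> card I = t \<and> card J = t}"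

text \<open>The matrix library counts rows and columns from 0, hence the shift by 1: the rows are
  \<open>X 1, \<dots>, X n\<close> and \<open>X 2, \<dots>, X (n + 1)\<close>.\<close>

definition N_mat :: "nat \<Rightarrow> (nat, 'a::comm_ring_1) mvpoly mat" where
  "N_mat n = mat 2 n (\<lambda>(i, j). X (i + j + 1))"

end

theory Submission
  imports Defs "HOL-Library.Product_Plus"
begin

text \<open>Send \<open>x\<^sub>i\<close> to \<open>s\<^bsup>n+1-i\<^esup> t\<^bsup>i-1\<^esup>\<close>. The kernel of this homomorphism on
  \<open>K[x\<^sub>1, \<dots>, x\<^bsub>n+1\<^esub>]\<close> is the ideal \<open>I\<close> of minors, and its image is the Veronese ring, spanned by the
  monomials \<open>s\<^sup>i t\<^sup>j\<close> with \<open>n dvd i + j\<close>. The generators \<open>f\<close>, \<open>g\<close> of \<open>J\<close> become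
  \<open>s\<^bsup>na\<^esup> + t\<^bsup>nb\<^esup>\<close> and \<open>(s t\<^bsup>n-1\<^esup>)\<^sup>c\<close>. A monomial that divides
  \<open>(s\<^bsup>na\<^esup> + t\<^bsup>nb\<^esup>) p\<close> divides \<open>p\<close> (\<open>monomial_dvd_cancel_binomial\<close>), and
  the quotient of \<open>p\<close> by the image of \<open>g\<close> stays in the Veronese ring, because \<open>n\<close> divides the degree
  of that image. So \<open>g\<close>, \<open>f\<close> is a regular sequence modulo \<open>I\<close>. For such generators the intersection and
  the product agree (\<open>Int_genideal_pair_eq_ideal_prod\<close>): a relation \<open>f p + g q \<in> I\<close> is,
  modulo \<open>I\<close>, a multiple of the trivial relation \<open>f g - g f = 0\<close>.

  That every element of the kernel lies in \<open>I\<close> (\<open>mem_ideal_minors_iff\<close>) is shown with normal forms: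
  the exchange relations \<open>x\<^sub>i x\<^sub>j = x\<^sub>k x\<^sub>l\<close> for \<open>i + j = k + l\<close> hold modulo \<open>I\<close> and reduce each monomial
  to one that contains at most one indeterminate other than \<open>x\<^sub>1\<close> and \<open>x\<^bsub>n+1\<^esub>\<close>. This
  normal form depends only on the image of the monomial in \<open>K[s, t]\<close>.\<close>

section \<open>Ideals generated by a regular sequence modulo another ideal\<close>

text \<open>If \<open>u = f p + g q\<close> lies in \<open>I\<close>, then \<open>regular_f\<close> yields \<open>r\<close> with \<open>p - g r \<in> I\<close>, and
  \<open>u = f (p - g r) + g (q + f r)\<close>. Here \<open>g (q + f r) = u - f (p - g r)\<close> is in \<open>I\<close>, hence so is
  \<open>q + f r\<close>, and both summands are in the product.\<close>

lemma (in cring) Int_genideal_pair_eq_ideal_prod: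
  assumes I: "ideal I R" and f: "f \<in> carrier R" and g: "g \<in> carrier R"
    and regular_g: "\<And>q. q \<in> carrier R \<Longrightarrow> g \<otimes> q \<in> I \<Longrightarrow> q \<in> I"
    and regular_f: "\<And>p q. p \<in> carrier R \<Longrightarrow> q \<in> carrier R \<Longrightarrow> f \<otimes> p \<oplus> g \<otimes> q \<in> I \<Longrightarrow>
      \<exists>r\<in>carrier R. p \<ominus> g \<otimes> r \<in> I"
  shows "I \<inter> Idl {f, g} = I \<cdot> (Idl {f, g})"
proof
  interpret I: ideal I R by (rule I)
  have fg: "{f, g} \<subseteq> Idl {f, g}"
    by (rule genideal_self) (simp add: f g)
  have "ideal (Idl {f, g}) R"
    by (rule genideal_ideal) (simp add: f g)
  then show "I \<cdot> (Idl {f, g}) \<subseteq> I \<inter> Idl {f, g}"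
    by (rule ideal_prod_inter[OF I])
  have "Idl {f, g} \<subseteq> PIdl f <+> PIdl g"
  proof (rule genideal_minimal)
    show "ideal (PIdl f <+> PIdl g) R"
      by (intro add_ideals cgenideal_ideal f g)
    have "f = f \<oplus> \<zero> \<otimes> g" "g = \<zero> \<otimes> f \<oplus> g"
      using f g by simp_all
    moreover have "\<zero> \<otimes> g \<in> PIdl g" "\<zero> \<otimes> f \<in> PIdl f"
      by (auto simp only: cgenideal_def zero_closed)
    ultimately show "{f, g} \<subseteq> PIdl f <+> PIdl g"
      using cgenideal_self[OF f] cgenideal_self[OF g] unfolding set_add_def' by blast
  qed
  have span: "\<exists>p\<in>carrier R. \<exists>q\<in>carrier R. u = f \<otimes> p \<oplus> g \<otimes> q" if "u \<in> Idl {f, g}" for u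
  proof -
    have "u \<in> (\<Union>h\<in>PIdl f. \<Union>k\<in>PIdl g. {h \<oplus> k})"
      using \<open>Idl {f, g} \<subseteq> _\<close> that unfolding set_add_def' by (rule subsetD)
    then obtain p q where "p \<in> carrier R" "q \<in> carrier R" "u = p \<otimes> f \<oplus> q \<otimes> g"
      unfolding cgenideal_def by auto
    then show ?thesis
      using m_comm[OF f] m_comm[OF g] by auto
  qed
  show "I \<inter> Idl {f, g} \<subseteq> I \<cdot> (Idl {f, g})"
  proof
    fix u assume u: "u \<in> I \<inter> Idl {f, g}"
    then obtain p q where p: "p \<in> carrier R" and q: "q \<in> carrier R"
      and u_eq: "u = f \<otimes> p \<oplus> g \<otimes> q"
      using span by blast
    with u obtain r where r: "r \<in> carrier R" and pr: "p \<ominus> g \<otimes> r \<in> I"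
      using regular_f by blast
    have "g \<otimes> (q \<oplus> f \<otimes> r) = u \<ominus> f \<otimes> (p \<ominus> g \<otimes> r)"
      unfolding u_eq using f g p q r by algebra
    moreover have "u \<ominus> f \<otimes> (p \<ominus> g \<otimes> r) \<in> I"
      using u pr f by (simp add: I.I_l_closed a_minus_def I.a_closed I.a_inv_closed)
    ultimately have qr: "q \<oplus> f \<otimes> r \<in> I"
      using regular_g f q r by simp
    have "u = (p \<ominus> g \<otimes> r) \<otimes> f \<oplus> (q \<oplus> f \<otimes> r) \<otimes> g"
      unfolding u_eq using f g p q r by algebra
    then show "u \<in> I \<cdot> (Idl {f, g})"
      using pr qr fg by (auto intro: ideal_prod.intros)
  qed
qed

section \<open>Linear maps between monoid algebras\<close>

lemma sum_single_lookup:
  "(\<Sum>m\<in>Poly_Mapping.keys p. Poly_Mapping.single m (Poly_Mapping.lookup p m)) = p"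
  by (rule poly_mapping_eqI)
    (auto simp: lookup_sum lookup_single when_def in_keys_iff)

lemma poly_mapping_additive_induct [case_names add single]:
  fixes p :: "'m \<Rightarrow>\<^sub>0 'b::comm_monoid_add"
  assumes "\<And>p q. P p \<Longrightarrow> P q \<Longrightarrow> P (p + q)" and single: "\<And>m c. P (Poly_Mapping.single m c)"
  shows "P p"
proof -
  have "P (\<Sum>m\<in>A. Poly_Mapping.single m (Poly_Mapping.lookup p m))" for A
    by (induction A rule: infinite_finite_induct) (use assms single[of undefined 0] in auto)
  from this[of "Poly_Mapping.keys p"] show ?thesis
    by (simp only: sum_single_lookup)
qed

text \<open>The linear extension of a map on monomials. It serves both for the homomorphism to \<open>K[s, t]\<close>
  and for its linear section, which sends a monomial to its normal form.\<close>

definition lin_ext ::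
  "('m \<Rightarrow> 'n \<Rightarrow>\<^sub>0 'a) \<Rightarrow> ('m \<Rightarrow>\<^sub>0 'a) \<Rightarrow> ('n::comm_monoid_add \<Rightarrow>\<^sub>0 'a::comm_ring_1)" where
  "lin_ext F p =
    (\<Sum>m\<in>Poly_Mapping.keys p. Poly_Mapping.single 0 (Poly_Mapping.lookup p m) * F m)"

lemma lin_ext_add: "lin_ext F (p + q) = lin_ext F p + lin_ext F q"
  unfolding lin_ext_def
  by (rule setsum_keys_plus_distrib) (simp_all add: single_add distrib_right)

lemma lin_ext_single: "lin_ext F (Poly_Mapping.single m c) = Poly_Mapping.single 0 c * F m"
  by (simp add: lin_ext_def)

lemma lin_ext_0 [simp]: "lin_ext F 0 = 0"
  by (simp add: lin_ext_def)

lemma lin_ext_diff: "lin_ext F (p - q) = lin_ext F p - lin_ext F q"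
  by (metis add_diff_cancel_right' diff_add_cancel lin_ext_add)

lemma lin_ext_comp:
  "lin_ext F (lin_ext (\<lambda>m. Poly_Mapping.single (h m) 1) p) = lin_ext (\<lambda>m. F (h m)) p"
  by (induction p rule: poly_mapping_additive_induct)
    (simp_all add: lin_ext_add lin_ext_single mult_single)

lemma lin_ext_cong: "(\<And>m. m \<in> Poly_Mapping.keys p \<Longrightarrow> F m = G m) \<Longrightarrow> lin_ext F p = lin_ext G p"
  by (simp add: lin_ext_def)

lemma lin_ext_monomial: "lin_ext (\<lambda>m. Poly_Mapping.single m 1) p = p"
  by (simp add: lin_ext_def mult_single sum_single_lookup)

lemma lin_ext_mult:
  assumes hom: "\<And>m m'. F (m + m') = F m * F m'"
  shows "lin_ext F (p * q) = lin_ext F p * lin_ext F q"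
proof (induction p rule: poly_mapping_additive_induct)
  case (single m c)
  show ?case
  proof (induction q rule: poly_mapping_additive_induct)
    case (single m' c')
    have "Poly_Mapping.single 0 (c * c') = Poly_Mapping.single 0 c * Poly_Mapping.single 0 c'"
      by (simp add: mult_single)
    then show ?case
      by (simp add: lin_ext_single hom mult_single ac_simps)
  qed (simp_all add: lin_ext_add algebra_simps)
qed (simp_all add: lin_ext_add algebra_simps)

section \<open>Monomials and ideals of a polynomial ring\<close>

text \<open>Monomials are exponent vectors, so multiplication by \<open>X i\<close> is addition of
  \<open>Poly_Mapping.single i 1\<close>.\<close>

lemma monomial_induct [consumes 1, case_names one times_X]:
  fixes m :: "'v \<Rightarrow>\<^sub>0 nat"
  assumes "Poly_Mapping.keys m \<subseteq> V" and "P 0"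
    and step: "\<And>i m. i \<in> V \<Longrightarrow> Poly_Mapping.keys m \<subseteq> V \<Longrightarrow> P m \<Longrightarrow> P (Poly_Mapping.single i 1 + m)"
  shows "P m"
  using assms(1)
proof (induction m rule: update_induct)
  case const
  show ?case by fact
next
  case (update m i k)
  have eq: "Poly_Mapping.update i k m = Poly_Mapping.single i k + m"
    using update(1)
    by (intro poly_mapping_eqI) (auto simp: lookup_update lookup_add lookup_single in_keys_iff)
  have i: "i \<in> V" and m: "Poly_Mapping.keys m \<subseteq> V"
    using update by (auto simp: keys_update)
  have "P (Poly_Mapping.single i k + m)" for k
  proof (induction k)
    case 0
    show ?case using update(3)[OF m] by simp
  next
    case (Suc k)
    have "Poly_Mapping.keys (Poly_Mapping.single i k + m) \<subseteq> V"
      using i m Poly_Mapping.keys_add[of "Poly_Mapping.single i k" m] by (auto split: if_splits)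
    from step[OF i this Suc] show ?case
      by (simp add: single_add[symmetric] add.assoc[symmetric])
  qed
  then show ?case by (simp only: eq)
qed

context
  fixes V :: "'v set"
begin

interpretation R: cring "poly_ring V :: ('v, 'a::comm_ring_1) mvpoly ring"
  by (rule cring_poly_ring)

lemma poly_ring_add_closed:
  "p \<in> carrier (poly_ring V) \<Longrightarrow> q \<in> carrier (poly_ring V) \<Longrightarrow>
    p + q \<in> carrier (poly_ring V :: ('v, 'a::comm_ring_1) mvpoly ring)"
  using R.a_closed by simp

lemma poly_ring_mult_closed:
  "p \<in> carrier (poly_ring V) \<Longrightarrow> q \<in> carrier (poly_ring V) \<Longrightarrow>
    p * q \<in> carrier (poly_ring V :: ('v, 'a::comm_ring_1) mvpoly ring)"
  using R.m_closed by simp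

lemma poly_ring_one_closed: "1 \<in> carrier (poly_ring V :: ('v, 'a::comm_ring_1) mvpoly ring)"
  using R.one_closed by simp

lemma poly_ring_power_closed:
  "p \<in> carrier (poly_ring V) \<Longrightarrow> p ^ k \<in> carrier (poly_ring V :: ('v, 'a::comm_ring_1) mvpoly ring)"
  by (induction k) (simp_all add: poly_ring_one_closed poly_ring_mult_closed)

lemma poly_ring_uminus_closed:
  "p \<in> carrier (poly_ring V) \<Longrightarrow> - p \<in> carrier (poly_ring V :: ('v, 'a::comm_ring_1) mvpoly ring)"
  by (auto simp: mem_carrier_poly_ring in_keys_iff)

lemma poly_ring_a_inv_eq:
  fixes q :: "('v, 'a::comm_ring_1) mvpoly"
  assumes "q \<in> carrier (poly_ring V)"
  shows "\<ominus>\<^bsub>poly_ring V\<^esub> q = - q"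
  by (rule R.minus_equality) (simp_all add: assms poly_ring_uminus_closed)

lemma poly_ring_minus_eq:
  fixes p q :: "('v, 'a::comm_ring_1) mvpoly"
  assumes "p \<in> carrier (poly_ring V)" "q \<in> carrier (poly_ring V)"
  shows "p \<ominus>\<^bsub>poly_ring V\<^esub> q = p - q"
  using assms by (simp add: a_minus_def poly_ring_a_inv_eq)

lemma poly_ring_diff_closed:
  "p \<in> carrier (poly_ring V) \<Longrightarrow> q \<in> carrier (poly_ring V) \<Longrightarrow>
    p - q \<in> carrier (poly_ring V :: ('v, 'a::comm_ring_1) mvpoly ring)"
  by (metis R.minus_closed poly_ring_minus_eq)

lemma poly_ring_const_closed:
  "Poly_Mapping.single 0 k \<in> carrier (poly_ring V :: ('v, 'a::comm_ring_1) mvpoly ring)"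
  by (simp add: mem_carrier_poly_ring)

lemma poly_ring_lin_ext_closed:
  assumes "\<And>m. F m \<in> carrier (poly_ring V :: ('v, 'a::comm_ring_1) mvpoly ring)"
  shows "lin_ext F p \<in> carrier (poly_ring V :: ('v, 'a::comm_ring_1) mvpoly ring)"
proof -
  have "(\<Sum>m\<in>A. Poly_Mapping.single 0 (Poly_Mapping.lookup p m) * F m)
    \<in> carrier (poly_ring V :: ('v, 'a::comm_ring_1) mvpoly ring)" for A
    by (induction A rule: infinite_finite_induct)
      (use R.zero_closed assms in
        \<open>auto intro: poly_ring_add_closed poly_ring_mult_closed poly_ring_const_closed\<close>)
  then show ?thesis by (simp add: lin_ext_def)
qed

context
  fixes I :: "('v, 'a::comm_ring_1) mvpoly set"
  assumes I: "ideal I (poly_ring V)"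
begin

interpretation I: ideal I "poly_ring V" by (rule I)

lemma poly_ideal_zero: "0 \<in> I"
  using I.zero_closed by simp

lemma poly_ideal_add: "p \<in> I \<Longrightarrow> q \<in> I \<Longrightarrow> p + q \<in> I"
  using I.a_closed by simp

lemma poly_ideal_mult: "r \<in> carrier (poly_ring V) \<Longrightarrow> p \<in> I \<Longrightarrow> r * p \<in> I"
  using I.I_l_closed by simp

lemma poly_ideal_uminus: "p \<in> I \<Longrightarrow> - p \<in> I"
  using poly_ideal_mult[OF poly_ring_uminus_closed[OF poly_ring_one_closed]] by simp

lemma poly_ideal_lin_ext:
  assumes "\<And>m. m \<in> Poly_Mapping.keys p \<Longrightarrow> F m \<in> I"
  shows "lin_ext F p \<in> I"
proof -
  have "(\<Sum>m\<in>A. Poly_Mapping.single 0 (Poly_Mapping.lookup p m) * F m) \<in> I"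
    if "A \<subseteq> Poly_Mapping.keys p" for A
    using that
    by (induction A rule: infinite_finite_induct)
      (use assms in
        \<open>auto intro: poly_ideal_zero poly_ideal_add poly_ideal_mult poly_ring_const_closed\<close>)
  then show ?thesis by (simp add: lin_ext_def)
qed

end

end

section \<open>Divisibility by a monomial in \<open>K[s, t]\<close>\<close>

text \<open>The ring \<open>K[s, t]\<close> is the monoid algebra of \<open>nat \<times> nat\<close>; the pair \<open>(i, j)\<close> stands for
  \<open>s\<^sup>i t\<^sup>j\<close>.\<close>

lemma lookup_single_times:
  fixes p :: "nat \<times> nat \<Rightarrow>\<^sub>0 'a::comm_ring_1"
  shows "Poly_Mapping.lookup (Poly_Mapping.single (u, v) 1 * p) (i, j) =
    (if u \<le> i \<and> v \<le> j then Poly_Mapping.lookup p (i - u, j - v) else 0)"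
  by (induction p rule: poly_mapping_additive_induct)
    (auto simp: distrib_left lookup_add mult_single lookup_single when_def)

lemma single_times_cancel:
  fixes p :: "nat \<times> nat \<Rightarrow>\<^sub>0 'a::comm_ring_1"
  assumes "Poly_Mapping.single (u, v) 1 * p = 0"
  shows "p = 0"
proof (rule poly_mapping_eqI)
  fix w :: "nat \<times> nat"
  obtain i j where w: "w = (i, j)" by force
  show "Poly_Mapping.lookup p w = Poly_Mapping.lookup 0 w"
    using arg_cong[OF assms, of "\<lambda>q. Poly_Mapping.lookup q (u + i, v + j)"]
    by (simp add: w lookup_single_times)
qed

text \<open>The second property of the quotient keeps track of degrees: it places the quotient in the
  Veronese ring when \<open>p\<close> and the monomial are there.\<close>

lemma obtain_monomial_quotient:
  fixes p :: "nat \<times> nat \<Rightarrow>\<^sub>0 'a::comm_ring_1"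
  assumes "\<And>i j. (i, j) \<in> Poly_Mapping.keys p \<Longrightarrow> u \<le> i \<and> v \<le> j"
  obtains r where "p = Poly_Mapping.single (u, v) 1 * r"
    and "\<And>i j. (i, j) \<in> Poly_Mapping.keys r \<Longrightarrow> (u + i, v + j) \<in> Poly_Mapping.keys p"
proof
  let ?r = "lin_ext (\<lambda>w. Poly_Mapping.single (fst w - u, snd w - v) 1) p"
  have "Poly_Mapping.single (u, v) 1 * ?r =
    lin_ext (\<lambda>w. Poly_Mapping.single (u + (fst w - u), v + (snd w - v)) 1) p"
    by (induction p rule: poly_mapping_additive_induct)
      (simp_all add: lin_ext_add lin_ext_single distrib_left mult_single)
  also have "\<dots> = lin_ext (\<lambda>w. Poly_Mapping.single w 1) p"
    by (rule lin_ext_cong) (use assms in force)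
  finally show eq: "p = Poly_Mapping.single (u, v) 1 * ?r"
    by (simp add: lin_ext_monomial)
  fix i j assume "(i, j) \<in> Poly_Mapping.keys ?r"
  then show "(u + i, v + j) \<in> Poly_Mapping.keys p"
    by (subst eq) (simp add: in_keys_iff lookup_single_times)
qed

text \<open>The binomial \<open>s\<^sup>A + t\<^sup>B\<close> is coprime to every monomial. Without unique factorization: if
  \<open>j < v\<close>, the coefficient of \<open>s\<^bsup>A+i\<^esup> t\<^sup>j\<close> on the right vanishes, so
  the coefficient of \<open>p\<close> at \<open>(i, j)\<close> is zero if \<open>j < B\<close>, and otherwise opposite to the one at
  \<open>(A + i, j - B)\<close>, which is zero by induction on \<open>j\<close>. The bound on \<open>i\<close> is symmetric.\<close>

lemma monomial_dvd_cancel_binomial: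
  fixes p q :: "nat \<times> nat \<Rightarrow>\<^sub>0 'a::comm_ring_1"
  assumes "A > 0" and "B > 0"
    and eq: "(Poly_Mapping.single (A, 0) 1 + Poly_Mapping.single (0, B) 1) * p =
      Poly_Mapping.single (u, v) 1 * q"
    and mem: "(i, j) \<in> Poly_Mapping.keys p"
  shows "u \<le> i \<and> v \<le> j"
proof -
  have coeff: "(if A \<le> i then Poly_Mapping.lookup p (i - A, j) else 0)
      + (if B \<le> j then Poly_Mapping.lookup p (i, j - B) else 0)
      = (if u \<le> i \<and> v \<le> j then Poly_Mapping.lookup q (i - u, j - v) else 0)" for i j
    using arg_cong[OF eq, of "\<lambda>r. Poly_Mapping.lookup r (i, j)"]
    by (simp add: distrib_right lookup_add lookup_single_times cong: if_cong split del: if_split)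
  have "Poly_Mapping.lookup p (i, j) = 0" if "j < v" for i j
    using that
  proof (induction j arbitrary: i rule: less_induct)
    case (less j)
    have "Poly_Mapping.lookup p (A + i, j - B) = 0" if "B \<le> j"
      using less that \<open>B > 0\<close> by simp
    then show ?case using coeff[of "A + i" j] less.prems by (auto split: if_splits)
  qed
  moreover have "Poly_Mapping.lookup p (i, j) = 0" if "i < u" for i j
    using that
  proof (induction i arbitrary: j rule: less_induct)
    case (less i)
    have "Poly_Mapping.lookup p (i - A, B + j) = 0" if "A \<le> i"
      using less that \<open>A > 0\<close> by simp
    then show ?case using coeff[of i "B + j"] less.prems by (auto split: if_splits)
  qed
  ultimately show ?thesis
    using mem by (meson in_keys_iff not_le)
qed

section \<open>The minors of the Hankel matrix\<close>

lemma pick_pair: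
  assumes "i < j"
  shows "pick {i, j} 0 = i" and "pick {i, j} (Suc 0) = j"
proof -
  show *: "pick {i, j} 0 = i"
    using assms by (auto intro!: Least_equality)
  show "pick {i, j} (Suc 0) = j"
    unfolding pick.simps(2) * using assms by (auto intro!: Least_equality)
qed

lemma det_2x2:
  fixes A :: "'a::comm_ring_1 mat"
  assumes A: "A \<in> carrier_mat 2 2"
  shows "det A = A $$ (0, 0) * A $$ (1, 1) - A $$ (0, 1) * A $$ (1, 0)"
proof -
  have "det (mat_delete A i 0) = A $$ (1 - i, 1)" if "i < 2" for i
  proof -
    have "mat_delete A i 0 \<in> carrier_mat 1 1"
      using mat_delete_carrier[OF A] by simp
    then show ?thesis
      using A that by (subst det_single) (auto simp: mat_delete_def)
  qed
  then show ?thesis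
    using laplace_expansion_column[OF A, of 0]
    by (simp add: cofactor_def numeral_2_eq_2)
qed

lemma minors_N_mat:
  "minors 2 (N_mat n :: (nat, 'a::comm_ring_1) mvpoly mat) =
    {X (i + 1) * X (j + 2) - X (j + 1) * X (i + 2) | i j. i < j \<and> j < n}"
proof -
  let ?N = "N_mat n :: (nat, 'a) mvpoly mat"
  have det: "det (submatrix ?N {0, 1} {i, j}) = X (i + 1) * X (j + 2) - X (j + 1) * X (i + 2)"
    if ij: "i < j" "j < n" for i j
  proof -
    have "{k. k < dim_row ?N \<and> k \<in> {0, 1}} = {0, 1}"
      and "{k. k < dim_col ?N \<and> k \<in> {i, j}} = {i, j}"
      using ij by (auto simp: N_mat_def)
    then have rows: "card {k. k < dim_row ?N \<and> k \<in> {0, 1}} = 2"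
      and cols: "card {k. k < dim_col ?N \<and> k \<in> {i, j}} = 2"
      using ij by (simp_all only: card_2_iff) auto
    have "submatrix ?N {0, 1} {i, j} \<in> carrier_mat 2 2"
      by (intro carrier_matI) (simp_all only: dim_submatrix rows cols)
    moreover have "submatrix ?N {0, 1} {i, j} $$ (k, l) = X (k + (if l = 0 then i else j) + 1)"
      if "k < 2" "l < 2" for k l
    proof -
      have "submatrix ?N {0, 1} {i, j} $$ (k, l) = ?N $$ (pick {0, 1} k, pick {i, j} l)"
        using that by (intro submatrix_index) (simp_all only: rows cols)
      also have "pick {0, 1} k = k"
        using pick_pair[of 0 1] that by (auto simp: less_2_cases_iff)
      also have "pick {i, j} l = (if l = 0 then i else j)"
        using pick_pair[OF ij(1)] that by (auto simp: less_2_cases_iff simp del: pick.simps)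
      finally show ?thesis
        using that ij by (simp add: N_mat_def)
    qed
    ultimately show ?thesis
      by (subst det_2x2) (simp_all add: add.commute)
  qed
  show ?thesis
  proof (rule subset_antisym; rule subsetI)
    fix d assume "d \<in> minors 2 ?N"
    then obtain I J where IJ: "I \<subseteq> {..<2}" "J \<subseteq> {..<n}" "card I = 2" "card J = 2"
      and d: "d = det (submatrix ?N I J)"
      by (auto simp: minors_def N_mat_def)
    have I: "I = {0, 1}"
      using card_subset_eq[of "{..<2}" I] IJ by (simp add: lessThan_Suc numeral_2_eq_2 insert_commute)
    obtain i j where J: "J = {i, j}" "i < j"
      using IJ(4) by (metis card_2_iff insert_commute linorder_neqE_nat)
    then show "d \<in> {X (i + 1) * X (j + 2) - X (j + 1) * X (i + 2) | i j. i < j \<and> j < n}"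
      using det[of i j] IJ(2) unfolding d I by blast
  next
    fix d :: "(nat, 'a) mvpoly"
    assume "d \<in> {X (i + 1) * X (j + 2) - X (j + 1) * X (i + 2) | i j. i < j \<and> j < n}"
    then obtain i j where ij: "i < j" "j < n" and d: "d = det (submatrix ?N {0, 1} {i, j})"
      using det by auto
    show "d \<in> minors 2 ?N"
      unfolding minors_def d using ij
      by (intro CollectI exI[of _ "{0, 1}"] exI[of _ "{i, j}"]) (auto simp: N_mat_def)
  qed
qed

section \<open>The parametrization of the rational normal curve\<close>

text \<open>The exponents of \<open>s\<close> and \<open>t\<close> in the image of a monomial.\<close>

definition st_exponent :: "nat \<Rightarrow> (nat \<Rightarrow>\<^sub>0 nat) \<Rightarrow> nat \<times> nat" where
  "st_exponent n m =
    (\<Sum>i\<in>Poly_Mapping.keys m. Poly_Mapping.lookup m i * (n + 1 - i),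
     \<Sum>i\<in>Poly_Mapping.keys m. Poly_Mapping.lookup m i * (i - 1))"

lemma st_exponent_add: "st_exponent n (m + m') = st_exponent n m + st_exponent n m'"
proof -
  have *: "(\<Sum>i\<in>Poly_Mapping.keys (m + m'). Poly_Mapping.lookup (m + m') i * k i) =
    (\<Sum>i\<in>Poly_Mapping.keys m. Poly_Mapping.lookup m i * k i)
    + (\<Sum>i\<in>Poly_Mapping.keys m'. Poly_Mapping.lookup m' i * k i)"
    for k :: "nat \<Rightarrow> nat"
    by (rule setsum_keys_plus_distrib) (simp_all add: distrib_right)
  show ?thesis
    unfolding st_exponent_def by (simp add: *)
qed

lemma st_exponent_single: "st_exponent n (Poly_Mapping.single i 1) = (n + 1 - i, i - 1)"
  by (simp add: st_exponent_def)

lemma st_exponent_0 [simp]: "st_exponent n 0 = 0"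
  by (simp add: st_exponent_def zero_prod_def)

lemma dvd_st_exponent:
  assumes "Poly_Mapping.keys m \<subseteq> {1..n + 1}"
  shows "n dvd fst (st_exponent n m) + snd (st_exponent n m)"
  using assms
proof (induction m rule: monomial_induct)
  case (times_X i m)
  have "fst (st_exponent n (Poly_Mapping.single i 1 + m))
      + snd (st_exponent n (Poly_Mapping.single i 1 + m))
    = n + (fst (st_exponent n m) + snd (st_exponent n m))"
    using times_X(1) by (simp only: st_exponent_add st_exponent_single) auto
  with times_X(3) show ?case by (simp only: dvd_add_triv_left_iff)
qed simp

text \<open>The homomorphism \<open>x\<^sub>i \<mapsto> s\<^bsup>n+1-i\<^esup> t\<^bsup>i-1\<^esup>\<close> that parametrizes the rational
  normal curve of degree \<open>n\<close>. It is total on polynomials in all indeterminates; for indices outside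
  \<open>{1..n + 1}\<close> the truncated differences give the exponents no meaning.\<close>

definition rnc :: "nat \<Rightarrow> (nat, 'a::comm_ring_1) mvpoly \<Rightarrow> (nat \<times> nat \<Rightarrow>\<^sub>0 'a)" where
  "rnc n = lin_ext (\<lambda>m. Poly_Mapping.single (st_exponent n m) 1)"

lemma rnc_add: "rnc n (p + q) = rnc n p + rnc n q"
  and rnc_diff: "rnc n (p - q) = rnc n p - rnc n q"
  and rnc_0 [simp]: "rnc n 0 = 0"
  by (simp_all add: rnc_def lin_ext_add lin_ext_diff)

lemma rnc_uminus: "rnc n (- p) = - rnc n p"
  using rnc_diff[of n 0 p] by simp

lemma rnc_mult: "rnc n (p * q) = rnc n p * rnc n q"
  unfolding rnc_def by (rule lin_ext_mult) (simp add: st_exponent_add mult_single)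

lemma rnc_single: "rnc n (Poly_Mapping.single m c) = Poly_Mapping.single (st_exponent n m) c"
  by (simp add: rnc_def lin_ext_single mult_single)

lemma rnc_X: "rnc n (X i) = Poly_Mapping.single (n + 1 - i, i - 1) 1"
  by (simp add: X_def rnc_single st_exponent_single del: One_nat_def)

lemma rnc_1: "rnc n 1 = 1"
  using rnc_single[of n 0 1] by simp

lemma rnc_X_power: "rnc n (X i ^ k) = Poly_Mapping.single (k * (n + 1 - i), k * (i - 1)) 1"
proof (induction k)
  case 0
  then show ?case
    using rnc_1[of n] by (simp flip: zero_prod_def)
next
  case (Suc k)
  then show ?case by (simp add: rnc_mult rnc_X mult_single)
qed

lemma dvd_keys_rnc:
  assumes "p \<in> carrier (poly_ring {1..n + 1})" and "(i, j) \<in> Poly_Mapping.keys (rnc n p)"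
  shows "n dvd i + j"
proof -
  have "Poly_Mapping.keys (rnc n p) \<subseteq> st_exponent n ` Poly_Mapping.keys p"
    unfolding rnc_def lin_ext_def
    by (rule order.trans[OF keys_sum]) (auto simp: mult_single)
  then obtain m where "m \<in> Poly_Mapping.keys p" and "(i, j) = st_exponent n m"
    using assms(2) by blast
  then show ?thesis
    using assms(1) dvd_st_exponent[of m n] by (simp only: mem_carrier_poly_ring) (metis fst_conv snd_conv)
qed

text \<open>A monomial \<open>x\<^sub>1\<^bsup>\<alpha>\<^esup> x\<^bsub>e+1\<^esub> x\<^bsub>n+1\<^esub>\<^bsup>\<beta>\<^esup>\<close> or
  \<open>x\<^sub>1\<^bsup>\<alpha>\<^esup> x\<^bsub>n+1\<^esub>\<^bsup>\<beta>\<^esup>\<close> whose image is \<open>s\<^sup>i t\<^sup>j\<close>, provided that \<open>n\<close>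
  divides \<open>i + j\<close>. Since \<open>x\<^bsub>e+1\<^esub>\<close> has \<open>t\<close>-degree \<open>e\<close> and \<open>x\<^bsub>n+1\<^esub>\<close> has \<open>t\<close>-degree
  \<open>n\<close>, the exponents come from division of \<open>j\<close>, and likewise of \<open>i\<close>, by \<open>n\<close>.\<close>

definition nf :: "nat \<Rightarrow> nat \<times> nat \<Rightarrow> (nat, 'a::comm_ring_1) mvpoly" where
  "nf n = (\<lambda>(i, j).
    X 1 ^ (i div n) * (if n dvd j then 1 else X (j mod n + 1)) * X (n + 1) ^ (j div n))"

lemma nf_0 [simp]: "nf n 0 = 1"
  by (simp add: nf_def zero_prod_def)

text \<open>Allowing \<open>e = 0\<close> and \<open>e = n\<close> gives all normal forms except \<open>1\<close> one shape, at the price of a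
  representation that is no longer unique.\<close>

lemma nf_eq:
  assumes "n > 0" and "e \<le> n"
  shows "nf n (n * \<alpha> + (n - e), n * \<beta> + e) = X 1 ^ \<alpha> * X (e + 1) * X (n + 1) ^ \<beta>"
proof -
  consider "e = 0" | "0 < e" "e < n" | "e = n"
    using assms by linarith
  then show ?thesis
  proof cases
    case 2
    then have "\<not> n dvd n * \<beta> + e"
      by (auto simp: dvd_add_right_iff dest: dvd_imp_le)
    moreover have "(n * \<alpha> + (n - e)) div n = \<alpha>" "(n * \<beta> + e) div n = \<beta>"
      by (rule div_nat_eqI; use 2 in simp)+
    moreover have "(n * \<beta> + e) mod n = e"
      using 2 by simp
    ultimately show ?thesis
      by (simp only: nf_def prod.case if_False)
  qed (use assms in \<open>simp_all add: nf_def\<close>)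
qed

lemma exponent_pair_cases:
  fixes n i j :: nat
  assumes "n > 0" and "n dvd i + j"
  obtains "(i, j) = 0" | \<alpha> e \<beta> where "e \<le> n" and "(i, j) = (n * \<alpha> + (n - e), n * \<beta> + e)"
proof (cases "n dvd j")
  case True
  then have "n dvd i" using dvd_diff_nat[OF assms(2) True] by simp
  with True obtain \<alpha> \<beta> where ij: "i = n * \<alpha>" "j = n * \<beta>" by (auto elim!: dvdE)
  show ?thesis
  proof (cases \<alpha>)
    case (Suc \<alpha>')
    then show ?thesis using that(2)[of 0 \<alpha>' \<beta>] ij by simp
  next
    case 0
    then show ?thesis using that(1) that(2)[of n 0 "\<beta> - 1"] ij
      by (cases \<beta>) (auto simp: zero_prod_def)
  qed
next
  case False
  define e where "e = j mod n"
  have e: "0 < e" "e < n" using False assms by (auto simp: e_def mod_greater_zero_iff_not_dvd)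
  have j: "j = n * (j div n) + e" by (simp add: e_def)
  have "n dvd i + e"
    using assms(2) j by (metis add.assoc add.left_commute dvd_add_right_iff dvd_triv_left)
  then obtain k where k: "i + e = n * k" by (auto elim: dvdE)
  with e obtain \<alpha> where "k = Suc \<alpha>" by (cases k) auto
  with k e have "i = n * \<alpha> + (n - e)" by simp
  with j e show ?thesis using that(2)[of e \<alpha> "j div n"] by simp
qed

lemma rnc_nf:
  assumes "n > 0" and "n dvd i + j"
  shows "rnc n (nf n (i, j)) = Poly_Mapping.single (i, j) 1"
  using assms
proof (cases rule: exponent_pair_cases)
  case 1
  then show ?thesis by (simp add: rnc_1)
next
  case (2 \<alpha> e \<beta>)
  then show ?thesis
    using assms by (simp only: nf_eq) (simp add: rnc_mult rnc_X_power rnc_X mult_single algebra_simps)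
qed

lemma nf_closed:
  assumes "n > 0"
  shows "nf n w \<in> carrier (poly_ring {1..n + 1})"
proof -
  have "j mod n + 1 \<in> {1..n + 1}" for j
    using mod_less_divisor[OF assms, of j] by simp
  then have middle: "(if n dvd j then 1 else X (j mod n + 1)) \<in> carrier (poly_ring {1..n + 1})" for j
    by (simp add: poly_ring_one_closed X_in_carrier del: Suc_eq_plus1 One_nat_def atLeastAtMost_iff)
  show ?thesis
    unfolding nf_def case_prod_beta
    by (intro middle poly_ring_mult_closed poly_ring_power_closed X_in_carrier) simp_all
qed

section \<open>The ideal of minors as the kernel of the parametrization\<close>

context
  fixes n :: nat and S :: "(nat, 'a::comm_ring_1) mvpoly ring" and I
  defines "S \<equiv> poly_ring {1..n + 1}"
  defines "I \<equiv> Idl\<^bsub>S\<^esub> (minors 2 (N_mat n))"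
begin

interpretation S: cring S
  unfolding S_def by (rule cring_poly_ring)

lemma minors_in_carrier: "minors 2 (N_mat n) \<subseteq> carrier S"
  unfolding minors_N_mat S_def
  by (auto intro!: poly_ring_diff_closed poly_ring_mult_closed X_in_carrier)

lemma ideal_minors: "ideal I S"
  unfolding I_def by (intro S.genideal_ideal minors_in_carrier)

lemma rnc_ideal_minors:
  assumes "p \<in> I"
  shows "rnc n p = 0"
proof -
  have "ideal {p \<in> carrier S. rnc n p = 0} S"
  proof (rule idealI)
    show "subgroup {p \<in> carrier S. rnc n p = 0} (add_monoid S)"
    proof (rule S.add.subgroupI)
      fix p assume p: "p \<in> {p \<in> carrier S. rnc n p = 0}"
      then have "\<ominus>\<^bsub>S\<^esub> p = - p"
        unfolding S_def by (intro poly_ring_a_inv_eq) simp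
      with p S.a_inv_closed[of p] show "\<ominus>\<^bsub>S\<^esub> p \<in> {p \<in> carrier S. rnc n p = 0}"
        by (simp add: rnc_uminus)
    qed (use S.zero_closed in \<open>auto simp: S_def rnc_add intro: poly_ring_add_closed\<close>)
  qed (auto simp: S_def rnc_mult intro: poly_ring_mult_closed cring.axioms(1)[OF cring_poly_ring])
  moreover have "minors 2 (N_mat n) \<subseteq> {p \<in> carrier S. rnc n p = 0}"
    using minors_in_carrier
    by (auto simp: minors_N_mat rnc_diff rnc_mult rnc_X mult_single add.commute)
  ultimately show ?thesis
    using S.genideal_minimal assms unfolding I_def by blast
qed

text \<open>For \<open>i < j\<close> this is a minor, for \<open>i > j\<close> the negative of one, and for \<open>i = j\<close> it is zero.\<close>

lemma exchange_step:
  assumes "i < n" "j < n"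
  shows "X (i + 1) * X (j + 2) - X (i + 2) * X (j + 1) \<in> I"
proof -
  have minor: "X (i + 1) * X (j + 2) - X (j + 1) * X (i + 2) \<in> I" if "i < j" "j < n" for i j
    using that S.genideal_self[OF minors_in_carrier] unfolding I_def minors_N_mat by blast
  consider "i < j" | "i = j" | "j < i" by linarith
  then show ?thesis
  proof cases
    case 1
    then show ?thesis using minor[of i j] assms by (simp only: mult.commute)
  next
    case 2
    then show ?thesis
      using poly_ideal_zero[OF ideal_minors[unfolded S_def]] by (simp add: mult.commute)
  next
    case 3
    then show ?thesis
      using poly_ideal_uminus[OF ideal_minors[unfolded S_def] minor[of j i]] assms
      by (simp add: mult.commute)
  qed
qed

text \<open>Index sums are preserved, so this covers every relation \<open>x\<^sub>i x\<^sub>j = x\<^sub>k x\<^sub>l\<close> with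
  \<open>i + j = k + l\<close>: it is a chain of \<open>t\<close> steps that move the two indices by one each.\<close>

lemma exchange:
  assumes "t \<le> i" "i \<le> n" "j + t \<le> n"
  shows "X (i + 1) * X (j + 1) - X (i - t + 1) * X (j + t + 1) \<in> I"
  using assms
proof (induction t)
  case 0
  show ?case using poly_ideal_zero[OF ideal_minors[unfolded S_def]] by simp
next
  case (Suc t)
  obtain s where s: "i = s + Suc t"
    using Suc.prems by (metis add.commute le_add_diff_inverse)
  let ?d = "X (i - Suc t + 1) * X (j + t + 2) - X (i - Suc t + 2) * X (j + t + 1)
    :: (nat, 'a) mvpoly"
  have "?d \<in> I"
    using Suc.prems by (intro exchange_step) auto
  then have "- ?d \<in> I"
    by (rule poly_ideal_uminus[OF ideal_minors[unfolded S_def]])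
  moreover have "X (i + 1) * X (j + 1) - X (i - t + 1) * X (j + t + 1) \<in> I"
    using Suc by simp
  ultimately have "(X (i + 1) * X (j + 1) - X (i - t + 1) * X (j + t + 1)) + - ?d \<in> I"
    by (intro poly_ideal_add[OF ideal_minors[unfolded S_def]])
  then show ?case
    by (simp add: s numeral_2_eq_2)
qed

text \<open>The product of an indeterminate and a normal form contains up to two factors other than
  \<open>x\<^sub>1\<close> and \<open>x\<^bsub>n+1\<^esub>\<close>, say \<open>x\<^bsub>k+1\<^esub>\<close> and \<open>x\<^bsub>e+1\<^esub>\<close>. One exchange turns one of them into \<open>x\<^sub>1\<close> if
  \<open>k + e \<le> n\<close>, and into \<open>x\<^bsub>n+1\<^esub>\<close> otherwise.\<close>

lemma X_times_nf:
  fixes i j k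
  defines "F \<equiv> nf n :: nat \<times> nat \<Rightarrow> (nat, 'a) mvpoly"
  assumes "n > 0" and "n dvd i + j" and "k \<le> n"
  shows "X (k + 1) * F (i, j) - F (n - k + i, k + j) \<in> I"
proof -
  note F_eq = nf_eq[where 'a = 'a, OF assms(2), folded F_def]
  from assms(2,3) show ?thesis
  proof (cases rule: exponent_pair_cases)
    case 1
    then have "F (i, j) = (1 :: (nat, 'a) mvpoly)"
      by (simp only: F_def nf_0)
    then have "X (k + 1) * F (i, j) = F (n - k + i, k + j)"
      using F_eq[OF assms(4), of 0 0] 1 by (simp add: zero_prod_def)
    then show ?thesis
      using poly_ideal_zero[OF ideal_minors[unfolded S_def]] by simp
  next
    case (2 \<alpha> e \<beta>)
    let ?c = "X 1 ^ \<alpha> * X (n + 1) ^ \<beta> :: (nat, 'a) mvpoly"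
    have c: "?c \<in> carrier (poly_ring {1..n + 1})"
      by (intro poly_ring_mult_closed poly_ring_power_closed X_in_carrier) auto
    have lhs: "X (k + 1) * F (i, j) = ?c * (X (k + 1) * X (e + 1))"
      unfolding 2(2) F_eq[OF 2(1)] by (simp only: mult_ac)
    have reduce: "X (k + 1) * F (i, j) - F w \<in> I"
      if "F w = ?c * q" and "X (k + 1) * X (e + 1) - q \<in> I" for w q
      using poly_ideal_mult[OF ideal_minors[unfolded S_def] c that(2)]
      by (simp only: lhs that(1) right_diff_distrib)
    show ?thesis
    proof (cases "k + e \<le> n")
      case True
      have "n - k + i = n * Suc \<alpha> + (n - (k + e))" "k + j = n * \<beta> + (k + e)"
        using 2 True by auto
      then have "F (n - k + i, k + j) = ?c * (X (k - k + 1) * X (e + k + 1))"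
        using F_eq[OF True, of "Suc \<alpha>" \<beta>] by (simp add: mult_ac add_ac)
      moreover have "X (k + 1) * X (e + 1) - X (k - k + 1) * X (e + k + 1) \<in> I"
        using True assms by (intro exchange) auto
      ultimately show ?thesis
        by (rule reduce)
    next
      case False
      have exponents: "n - k + i = n * \<alpha> + (n - (k + e - n))" "k + j = n * Suc \<beta> + (k + e - n)"
        and shift: "k - (n - e) = k + e - n" "e + (n - e) = n"
        using 2 False assms by auto
      have "k + e - n \<le> n"
        using 2(1) assms(4) by simp
      then have "F (n - k + i, k + j) = ?c * (X (k - (n - e) + 1) * X (e + (n - e) + 1))"
        unfolding exponents shift by (simp only: F_eq power_Suc) (simp only: mult_ac)
      moreover have "X (k + 1) * X (e + 1) - X (k - (n - e) + 1) * X (e + (n - e) + 1) \<in> I"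
        using False assms 2 by (intro exchange) auto
      ultimately show ?thesis
        by (rule reduce)
    qed
  qed
qed

lemma monomial_minus_nf:
  assumes "n > 0" and "Poly_Mapping.keys m \<subseteq> {1..n + 1}"
  shows "Poly_Mapping.single m 1 - nf n (st_exponent n m) \<in> I"
  using assms(2)
proof (induction m rule: monomial_induct)
  case one
  show ?case using poly_ideal_zero[OF ideal_minors[unfolded S_def]] by simp
next
  case (times_X i m)
  obtain u v where uv: "st_exponent n m = (u, v)" by force
  let ?m = "Poly_Mapping.single m 1 :: (nat, 'a) mvpoly"
  have "X (i - 1 + 1) * nf n (u, v) - nf n (n - (i - 1) + u, i - 1 + v) \<in> I"
    using times_X(1) dvd_st_exponent[OF times_X(2)] by (intro X_times_nf assms(1)) (auto simp: uv)
  moreover have "st_exponent n (Poly_Mapping.single i 1 + m) = (n - (i - 1) + u, i - 1 + v)"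
    using times_X(1) by (simp only: st_exponent_add st_exponent_single uv) auto
  moreover have "i - 1 + 1 = i"
    using times_X(1) by simp
  ultimately have "X i * nf n (u, v) - nf n (st_exponent n (Poly_Mapping.single i 1 + m)) \<in> I"
    by (simp only:)
  moreover have "X i * (?m - nf n (u, v)) \<in> I"
    using poly_ideal_mult[OF ideal_minors[unfolded S_def] X_in_carrier[OF times_X(1)] times_X(3)]
    by (simp only: uv)
  ultimately have "X i * (?m - nf n (u, v)) +
    (X i * nf n (u, v) - nf n (st_exponent n (Poly_Mapping.single i 1 + m))) \<in> I"
    by (rule poly_ideal_add[OF ideal_minors[unfolded S_def], rotated])
  moreover have "Poly_Mapping.single (Poly_Mapping.single i 1 + m) 1 = X i * ?m"
    by (simp add: X_def mult_single)
  ultimately show ?case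
    by (simp add: right_diff_distrib)
qed

text \<open>Replacing each monomial of \<open>p\<close> by its normal form changes \<open>p\<close> by an element of \<open>I\<close>. The result
  is the image of \<open>rnc n p\<close> under the linear extension of \<open>nf\<close>, hence zero for \<open>p\<close> in the kernel.\<close>

lemma mem_ideal_minors_iff:
  assumes "n > 0" and p: "p \<in> carrier S"
  shows "p \<in> I \<longleftrightarrow> rnc n p = 0"
proof
  assume "rnc n p = 0"
  then have "lin_ext (nf n) (rnc n p) = 0" by simp
  then have "lin_ext (\<lambda>m. nf n (st_exponent n m)) p = 0"
    by (simp only: rnc_def lin_ext_comp)
  moreover have "lin_ext (\<lambda>m. Poly_Mapping.single m 1 - nf n (st_exponent n m)) p =
    lin_ext (\<lambda>m. Poly_Mapping.single m 1) p - lin_ext (\<lambda>m. nf n (st_exponent n m)) p"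
    by (simp only: lin_ext_def right_diff_distrib sum_subtractf)
  ultimately have "p = lin_ext (\<lambda>m. Poly_Mapping.single m 1 - nf n (st_exponent n m)) p"
    by (simp only: lin_ext_monomial diff_0_right)
  also have "\<dots> \<in> I"
    using p assms(1)
    by (intro poly_ideal_lin_ext[OF ideal_minors[unfolded S_def]] monomial_minus_nf)
      (auto simp: S_def mem_carrier_poly_ring)
  finally show "p \<in> I" .
qed (rule rnc_ideal_minors)

text \<open>The image is the full Veronese ring, because every monomial in it is the image of its normal
  form.\<close>

lemma obtain_rnc_preimage:
  assumes "n > 0" and "\<And>i j. (i, j) \<in> Poly_Mapping.keys r \<Longrightarrow> n dvd i + j"
  obtains p where "p \<in> carrier S" and "rnc n p = r"
proof
  show "lin_ext (nf n) r \<in> carrier S"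
    unfolding S_def by (intro poly_ring_lin_ext_closed nf_closed assms(1))
  have "rnc n (lin_ext (nf n) r) = lin_ext (\<lambda>w. rnc n (nf n w)) r"
  proof (induction r rule: poly_mapping_additive_induct)
    case (single w c)
    have "rnc n (Poly_Mapping.single 0 c) = Poly_Mapping.single 0 c"
      by (simp add: rnc_single)
    then show ?case by (simp add: lin_ext_single rnc_mult)
  qed (simp add: lin_ext_add rnc_add)
  also have "\<dots> = lin_ext (\<lambda>w. Poly_Mapping.single w 1) r"
    by (rule lin_ext_cong) (metis assms rnc_nf surj_pair)
  finally show "rnc n (lin_ext (nf n) r) = r"
    by (simp add: lin_ext_monomial)
qed

end

theorem theorem3p6:
  fixes n a b c :: nat
    and S :: "(nat, 'a::field) mvpoly ring"
    and I J :: "(nat, 'a) mvpoly set"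
  assumes "n \<ge> 2" and "a \<ge> 1" and "b \<ge> 1" and "c \<ge> 1"
  defines "S \<equiv> poly_ring {1..n + 1}"
    and "I \<equiv> Idl\<^bsub>S\<^esub> (minors 2 (N_mat n))"
    and "J \<equiv> Idl\<^bsub>S\<^esub> {X 1 ^ a + X (n + 1) ^ b, X n ^ c}"
  shows "I \<inter> J = I \<cdot>\<^bsub>S\<^esub> J"
proof -
  interpret S: cring S
    unfolding S_def by (rule cring_poly_ring)
  let ?f = "X 1 ^ a + X (n + 1) ^ b :: (nat, 'a) mvpoly"
  let ?g = "X n ^ c :: (nat, 'a) mvpoly"
  have n: "n > 0" using \<open>n \<ge> 2\<close> by simp
  have mem_I: "p \<in> I \<longleftrightarrow> rnc n p = 0" if "p \<in> carrier S" for p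
    using mem_ideal_minors_iff[OF n] that unfolding S_def I_def by blast
  have f: "?f \<in> carrier S" and g: "?g \<in> carrier S"
    using n unfolding S_def
    by (auto intro!: poly_ring_add_closed poly_ring_power_closed X_in_carrier)
  have rnc_f: "rnc n ?f = Poly_Mapping.single (a * n, 0) 1 + Poly_Mapping.single (0, b * n) 1"
    by (simp add: rnc_add rnc_X_power)
  have rnc_g: "rnc n ?g = Poly_Mapping.single (c, c * (n - 1)) 1"
    by (simp add: rnc_X_power)
  have closed: "p + q \<in> carrier S" "p * q \<in> carrier S" "p - q \<in> carrier S"
    if "p \<in> carrier S" "q \<in> carrier S" for p q
    using that unfolding S_def
    by (auto intro: poly_ring_add_closed poly_ring_mult_closed poly_ring_diff_closed)
  show ?thesis
    unfolding J_def
  proof (rule S.Int_genideal_pair_eq_ideal_prod[OF _ f g])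
    show "ideal I S"
      unfolding I_def S_def by (rule ideal_minors)
  next
    fix q assume q: "q \<in> carrier S" and "?g \<otimes>\<^bsub>S\<^esub> q \<in> I"
    then have "Poly_Mapping.single (c, c * (n - 1)) 1 * rnc n q = 0"
      using mem_I[of "?g * q"] closed g by (simp add: S_def rnc_mult rnc_g)
    then show "q \<in> I"
      using single_times_cancel mem_I[OF q] by blast
  next
    fix p q assume p: "p \<in> carrier S" and q: "q \<in> carrier S"
      and "?f \<otimes>\<^bsub>S\<^esub> p \<oplus>\<^bsub>S\<^esub> ?g \<otimes>\<^bsub>S\<^esub> q \<in> I"
    then have "?f * p + ?g * q \<in> I" by (simp add: S_def)
    then have "rnc n (?f * p + ?g * q) = 0"
      using mem_I[OF closed(1)[OF closed(2)[OF f p] closed(2)[OF g q]]] by blast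
    then have "(Poly_Mapping.single (a * n, 0) 1 + Poly_Mapping.single (0, b * n) 1) * rnc n p
        + Poly_Mapping.single (c, c * (n - 1)) 1 * rnc n q = 0"
      by (simp only: rnc_add[of n "_ * _"] rnc_mult rnc_f rnc_g)
    then have eq: "(Poly_Mapping.single (a * n, 0) 1 + Poly_Mapping.single (0, b * n) 1) * rnc n p
        = Poly_Mapping.single (c, c * (n - 1)) 1 * (- rnc n q)"
      by (simp add: eq_neg_iff_add_eq_0)
    have "a * n > 0" "b * n > 0"
      using n \<open>a \<ge> 1\<close> \<open>b \<ge> 1\<close> by auto
    note divides = monomial_dvd_cancel_binomial[OF this eq]
    obtain R where R: "rnc n p = Poly_Mapping.single (c, c * (n - 1)) 1 * R"
      and keys_R: "\<And>i j. (i, j) \<in> Poly_Mapping.keys R \<Longrightarrow>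
        (c + i, c * (n - 1) + j) \<in> Poly_Mapping.keys (rnc n p)"
      using obtain_monomial_quotient[of "rnc n p", OF divides] by metis
    \<comment> \<open>The image of \<open>g\<close> has degree \<open>n * c\<close>, so the quotient \<open>R\<close> is in the image of the
      parametrization.\<close>
    have "n dvd i + j" if "(i, j) \<in> Poly_Mapping.keys R" for i j
    proof -
      have "n dvd (c + i) + (c * (n - 1) + j)"
        using dvd_keys_rnc[OF p[unfolded S_def] keys_R[OF that]] .
      also have "(c + i) + (c * (n - 1) + j) = n * c + (i + j)"
        using n by (cases n) (auto simp: algebra_simps)
      finally show ?thesis
        by (simp add: dvd_add_right_iff)
    qed
    then obtain r where r: "r \<in> carrier S" and rnc_r: "rnc n r = R"
      using obtain_rnc_preimage[OF n] unfolding S_def by metis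
    have "p \<ominus>\<^bsub>S\<^esub> ?g \<otimes>\<^bsub>S\<^esub> r = p - ?g * r"
      using p closed(2)[OF g r] unfolding S_def by (simp add: poly_ring_minus_eq)
    moreover have "p - ?g * r \<in> I"
      using mem_I closed p g r by (simp add: rnc_diff rnc_mult R rnc_r rnc_g)
    ultimately have "p \<ominus>\<^bsub>S\<^esub> ?g \<otimes>\<^bsub>S\<^esub> r \<in> I"
      by (simp only:)
    with r show "\<exists>r\<in>carrier S. p \<ominus>\<^bsub>S\<^esub> ?g \<otimes>\<^bsub>S\<^esub> r \<in> I"
      by blast
  qed
qed

end
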